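(* Suppose that $I\subseteq\mathbb{R}$ is an interval containing the origin, that $f:I\to\mathbb{R}$ satisfies $0<f(x)<x$ for all $x\in I$ with $x>0$, and suppose that $f$ is differentiable at $x=0$ with $f'(0)=c$ for some $0\leq c<1$. Let $x_0\in I$ with $x_0>0$ be such that $\lim_{n\to\infty}f^n(x_0)=0$. Then the series $\sum_{n=0}^{\infty}f^n(x_0)$ is convergent.
   Context: $f^n$ denotes the $n$-fold composition $f\circ f\circ\cdots\circ f$ ($n$ times), with $f^0=\operatorname{Id}$. *)

theory Defs imports "HOL-Analysis.Analysis"
begin

end

theory Submission imports Defs
begin

text \<open>
  Write \<open>x\<^sub>n\<close> for the \<open>n\<close>-th iterate. The orbit stays in \<open>I\<close> and tends to \<open>0\<close> without ever
  reaching it, so the derivative at \<open>0\<close> can be computed along the orbit. Continuity of \<open>f\<close> at \<open>0\<close>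
  forces \<open>f 0 = lim f x\<^sub>n = lim x\<^sub>n\<^sub>+\<^sub>1 = 0\<close>, and therefore the difference quotients along the orbit
  are exactly the ratios \<open>x\<^sub>n\<^sub>+\<^sub>1 / x\<^sub>n\<close>. These tend to \<open>c < 1\<close>, and the ratio test applies.
\<close>

lemma funpow_orbit_in_interval:
  fixes I :: "real set"
  assumes "is_interval I" and "0 \<in> I"
    and decr: "\<And>x. x \<in> I \<Longrightarrow> x > 0 \<Longrightarrow> 0 < f x \<and> f x < x"
    and "x0 \<in> I" and "x0 > 0"
  shows "(f ^^ n) x0 \<in> I \<and> 0 < (f ^^ n) x0"
proof (induction n)
  case 0
  then show ?case using assms by simp
next
  case (Suc n)
  then have "0 < f ((f ^^ n) x0)" "f ((f ^^ n) x0) < (f ^^ n) x0"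
    using decr by auto
  moreover from this have "f ((f ^^ n) x0) \<in> I"
    using mem_is_interval_1_I[OF assms(1,2)] Suc by auto
  ultimately show ?case by simp
qed

text \<open>
  The ratio is the difference quotient of \<open>f\<close> between \<open>0\<close> and the current iterate once \<open>f 0 = 0\<close>,
  and \<open>f 0 = 0\<close> because the orbit shifted by one step has both limits \<open>f 0\<close> and \<open>0\<close>.
\<close>

lemma orbit_ratio_tendsto_derivative:
  fixes f :: "real \<Rightarrow> real"
  assumes deriv: "(f has_real_derivative c) (at 0 within S)"
    and orbit: "\<And>n. (f ^^ n) x0 \<in> S" "\<And>n. (f ^^ n) x0 \<noteq> 0"
    and lim: "(\<lambda>n. (f ^^ n) x0) \<longlonglongrightarrow> 0"
  shows "(\<lambda>n. (f ^^ Suc n) x0 / (f ^^ n) x0) \<longlonglongrightarrow> c"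
proof -
  have approach: "filterlim (\<lambda>n. (f ^^ n) x0) (at 0 within S) sequentially"
    using orbit lim by (auto simp: filterlim_at)
  have "(f \<longlongrightarrow> f 0) (at 0 within S)"
    using DERIV_continuous[OF deriv] by (simp add: continuous_within)
  from filterlim_compose[OF this approach]
  have "(\<lambda>n. (f ^^ Suc n) x0) \<longlonglongrightarrow> f 0" by simp
  then have "f 0 = 0"
    using LIMSEQ_unique LIMSEQ_Suc[OF lim] by blast
  then have "((\<lambda>y. f y / y) \<longlongrightarrow> c) (at 0 within S)"
    using deriv by (simp add: has_field_derivative_iff)
  from filterlim_compose[OF this approach] show ?thesis by simp
qed

theorem theorem2p5:
  fixes I :: "real set" and f :: "real \<Rightarrow> real" and c x0 :: real
  assumes "is_interval I" and "0 \<in> I"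
    and "\<And>x. x \<in> I \<Longrightarrow> x > 0 \<Longrightarrow> 0 < f x \<and> f x < x"
    and "(f has_real_derivative c) (at 0 within I)"
    and "0 \<le> c" and "c < 1"
    and "x0 \<in> I" and "x0 > 0"
    and "(\<lambda>n. (f ^^ n) x0) \<longlonglongrightarrow> 0"
  shows "summable (\<lambda>n. (f ^^ n) x0)"
proof -
  have orbit: "(f ^^ n) x0 \<in> I" "0 < (f ^^ n) x0" for n
    using funpow_orbit_in_interval[OF assms(1,2,3,7,8)] by auto
  then have "(f ^^ n) x0 \<noteq> 0" for n
    by (metis less_irrefl)
  then have ratio: "(\<lambda>n. (f ^^ Suc n) x0 / (f ^^ n) x0) \<longlonglongrightarrow> c"
    using orbit_ratio_tendsto_derivative[OF assms(4) orbit(1) _ assms(9)] by blast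
  obtain r where r: "c < r" "r < 1"
    using dense[OF assms(6)] by blast
  from order_tendstoD(2)[OF ratio r(1)] obtain N
    where "\<And>n. n \<ge> N \<Longrightarrow> (f ^^ Suc n) x0 / (f ^^ n) x0 < r"
    by (auto simp: eventually_sequentially)
  then have "(f ^^ Suc n) x0 \<le> r * (f ^^ n) x0" if "n \<ge> N" for n
    using that orbit(2)[of n] by (metis less_imp_le pos_divide_less_eq)
  then have "norm ((f ^^ Suc n) x0) \<le> r * norm ((f ^^ n) x0)" if "n \<ge> N" for n
    using that orbit(2)[of n] orbit(2)[of "Suc n"] by (metis abs_of_pos real_norm_def)
  then show ?thesis
    by (rule summable_ratio_test[OF r(2)])
qed

end
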